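(* Let $B$ be a Bernstein subset of $\mathbb{R}$ that is a subgroup of $(\mathbb{R},+)$, let $\mathcal{B}=\mathbb{R}/B=\{B+x:x\in\mathbb{R}\}$, and let $\mathcal{S}(\mathcal{V})$ be the semigroup generated by the collection $\mathcal{V}$ of all Vitali selectors of $\mathbb{R}$. Then the semigroup $\mathcal{S}(\mathcal{B})\vee \mathcal{S}(\mathcal{V})$ consists of sets which are not Lebesgue measurable, and it is invariant under the action of the group $\Phi(\mathbb{R})$ of all translations of $\mathbb{R}$.
   Context: A Bernstein set is a subset $B\subseteq\mathbb{R}$ such that $B\cap F\neq\emptyset$ and $(\mathbb{R}\setminus B)\cap F\neq\emptyset$ for every uncountable closed $F\subseteq\mathbb{R}$. For a countable dense subgroup $Q$ of $(\mathbb{R},+)$, a Vitali selector related to $Q$ is a set $V\subseteq\mathbb{R}$ containing exactly one element of each coset of $Q$; a Vitali selector of $\mathbb{R}$ is a Vitali selector related to some countable dense subgroup $Q$. For a non-empty family $\mathcal{A}$ of sets, the semigroup generated by $\mathcal{A}$ is $\mathcal{S}(\mathcal{A})=\{\bigcup_{i=1}^n A_i: A_i\in\mathcal{A}, n\in\mathbb{N}\}$ with $n\ge 1$. For families of sets, $\mathcal{A}\vee\mathcal{D}=\{A\cup D: A\in\mathcal{A}, D\in\mathcal{D}\}$. A semigroup of sets is a non-empty family of sets closed under finite unions. A family $\mathcal{O}$ of subsets of $\mathbb{R}$ is invariant under $\Phi(\mathbb{R})$ if $A+t\in\mathcal{O}$ for all $A\in\mathcal{O}$, $t\in\mathbb{R}$.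 *)

theory Defs
  imports "HOL-Analysis.Analysis" "HOL-Algebra.Coset"
begin

definition real_add_group :: "real monoid" where
  "real_add_group = \<lparr>carrier = UNIV, monoid.mult = (+), one = 0\<rparr>"

lemma group_real_add_group: "group real_add_group"
proof (rule groupI)
  fix x :: real
  show "\<exists>y\<in>carrier real_add_group. y \<otimes>\<^bsub>real_add_group\<^esub> x = \<one>\<^bsub>real_add_group\<^esub>"
    by (rule bexI[of _ "- x"]) (simp_all add: real_add_group_def)
qed (simp_all add: real_add_group_def)

lemma r_coset_real_add_group: "H #>\<^bsub>real_add_group\<^esub> x = (\<lambda>h. h + x) ` H"
  by (auto simp: r_coset_def real_add_group_def)

definition Bernstein_set :: "real set \<Rightarrow> bool" where
  "Bernstein_set B \<longleftrightarrow>
     (\<forall>F. closed F \<and> uncountable F \<longrightarrow> B \<inter> F \<noteq> {} \<and> (UNIV - B) \<inter> F \<noteq> {})"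

definition Vitali_selector_of :: "real set \<Rightarrow> real set \<Rightarrow> bool" where
  "Vitali_selector_of Q V \<longleftrightarrow> (\<forall>C \<in> rcosets\<^bsub>real_add_group\<^esub> Q. \<exists>!x. x \<in> V \<inter> C)"

definition Vitali_selectors :: "real set set" where
  "Vitali_selectors =
     {V. \<exists>Q. subgroup Q real_add_group \<and> countable Q \<and> closure Q = UNIV \<and> Vitali_selector_of Q V}"

text \<open>Finite unions are unions of at least one member throughout, so the empty set
  does not enter a semigroup as an empty union.\<close>

definition semigroup_of_sets :: "'a set set \<Rightarrow> bool" where
  "semigroup_of_sets \<S> \<longleftrightarrow>
     \<S> \<noteq> {} \<and> (\<forall>\<F>. finite \<F> \<and> \<F> \<noteq> {} \<and> \<F> \<subseteq> \<S> \<longrightarrow> \<Union>\<F> \<in> \<S>)"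

definition generated_semigroup :: "'a set set \<Rightarrow> 'a set set" where
  "generated_semigroup \<A> =
     {\<Union>i\<in>{1..n}. A i | (A :: nat \<Rightarrow> 'a set) n. 1 \<le> n \<and> (\<forall>i\<in>{1..n}. A i \<in> \<A>)}"

definition union_join :: "'a set set \<Rightarrow> 'a set set \<Rightarrow> 'a set set" where
  "union_join \<A> \<D> = {A \<union> D | A D. A \<in> \<A> \<and> D \<in> \<D>}"

definition real_translations :: "(real \<Rightarrow> real) set" where
  "real_translations = {(\<lambda>x. x + t) | t. True}"

definition invariant_family :: "('a \<Rightarrow> 'a) set \<Rightarrow> 'a set set \<Rightarrow> bool" where
  "invariant_family \<Phi> \<O> \<longleftrightarrow> (\<forall>\<phi>\<in>\<Phi>. \<forall>A\<in>\<O>. \<phi> ` A \<in> \<O>)"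

end

theory Submission
  imports Defs
begin

text \<open>Call \<open>S\<close> \<^emph>\<open>packable\<close> if infinitely many of its translates are pairwise disjoint. Vitali selectors
  are packable because countable dense subgroups are infinite, and cosets of \<open>B\<close> are packable
  because \<open>\<real>\<close> is divisible, so that its proper subgroup \<open>B\<close> has infinite index. By the
  pigeonhole principle, finitely many translates of the complement of a finite union of packable
  sets cover \<open>\<real>\<close>, so this complement is not Lebesgue null. On the other hand, a set
  containing a coset of \<open>B\<close> meets every uncountable closed set, so if it is Lebesgue measurable,
  then its complement is null by inner regularity.\<close>

section \<open>Packable sets and finite covers by translates of a complement\<close>

definition packable :: "'a::ab_group_add set \<Rightarrow> bool" where
  "packable S \<longleftrightarrow>
     (\<exists>F. infinite F \<and> (\<forall>x. \<forall>f\<in>F. \<forall>f'\<in>F. x - f \<in> S \<and> x - f' \<in> S \<longrightarrow> f = f'))"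

text \<open>If shifts \<open>T\<close> serve \<open>\<F>\<close> and \<open>S\<close> is added, sums
  of \<open>T\<close> with sufficiently many shifts \<open>G\<close> that pack \<open>S\<close>
  serve the larger family: two elements of \<open>G\<close> must share a shift in \<open>T\<close>,
  and at most one of them can lead into \<open>S\<close>.\<close>

lemma finite_translates_escape_packable:
  fixes \<F> :: "'a::ab_group_add set set"
  assumes "finite \<F>" "\<And>S. S \<in> \<F> \<Longrightarrow> packable S"
  shows "\<exists>T. finite T \<and> (\<forall>x. \<exists>t\<in>T. x - t \<notin> \<Union>\<F>)"
  using assms
proof (induction \<F>)
  case empty
  \<comment> \<open>The empty union is escaped by any shift, but \<open>T\<close> must contain at
    least one.\<close>
  show ?case by (rule exI[of _ "{0}"]) simp
next
  case (insert S \<F>)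
  then obtain T where T: "finite T" "\<forall>x. \<exists>t\<in>T. x - t \<notin> \<Union>\<F>" by auto
  have "packable S" by (rule insert.prems) simp
  then obtain F where "infinite F"
    and F: "\<forall>x. \<forall>f\<in>F. \<forall>f'\<in>F. x - f \<in> S \<and> x - f' \<in> S \<longrightarrow> f = f'"
    by (auto simp: packable_def)
  \<comment> \<open>One shift more than \<open>T\<close> has, so that no map from \<open>G\<close>
    to \<open>T\<close> is injective.\<close>
  obtain G where G: "finite G" "card G = Suc (card T)" "G \<subseteq> F"
    using infinite_arbitrarily_large[OF \<open>infinite F\<close>] by blast
  have "\<exists>u \<in> (\<lambda>(g, t). g + t) ` (G \<times> T). x - u \<notin> \<Union>(insert S \<F>)" for x
  proof -
    have "\<forall>g. \<exists>t. t \<in> T \<and> x - g - t \<notin> \<Union>\<F>"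
      using T(2) by (simp only: Bex_def) blast
    from choice[OF this] obtain \<tau>
      where \<tau>: "\<forall>g. \<tau> g \<in> T \<and> x - g - \<tau> g \<notin> \<Union>\<F>" by auto
    have "\<not> inj_on \<tau> G"
    proof
      assume "inj_on \<tau> G"
      then have "card G \<le> card T"
        using \<tau> T(1) by (intro card_inj_on_le[of \<tau>]) auto
      then show False using G by simp
    qed
    then obtain g h where gh: "g \<in> G" "h \<in> G" "g \<noteq> h" "\<tau> g = \<tau> h"
      unfolding inj_on_def by blast
    \<comment> \<open>The translates of \<open>S\<close> by \<open>g\<close> and \<open>h\<close>
      are disjoint, so the point \<open>x - \<tau> g\<close> lies outside one of them.\<close>
    have "x - \<tau> g - g \<notin> S \<or> x - \<tau> g - h \<notin> S"
      using F[rule_format, of g h "x - \<tau> g"] gh(1-3) G(3) by auto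
    then obtain k where k: "k \<in> G" "x - \<tau> k - k \<notin> S"
      using gh(1,2,4) by (cases "x - \<tau> g - g \<notin> S") auto
    then have "x - (k + \<tau> k) \<notin> \<Union>(insert S \<F>)"
      using \<tau>[rule_format, of k] by (simp add: diff_diff_eq add.commute)
    moreover have "k + \<tau> k \<in> (\<lambda>(g, t). g + t) ` (G \<times> T)"
      using k(1) \<tau>[rule_format, of k] by (intro image_eqI[of _ _ "(k, \<tau> k)"]) auto
    ultimately show ?thesis by blast
  qed
  moreover have "finite ((\<lambda>(g, t). g + t) ` (G \<times> T))"
    using G(1) T(1) by simp
  ultimately show ?case by blast
qed

text \<open>Finitely many translates of a null set form a null set, whereas the translates of this
  complement by \<open>T\<close> cover the line.\<close>

lemma packable_Union_complement_not_negligible: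
  fixes \<F> :: "real set set"
  assumes "finite \<F>" "\<And>S. S \<in> \<F> \<Longrightarrow> packable S"
  shows "\<not> negligible (- \<Union>\<F>)"
proof
  assume neg: "negligible (- \<Union>\<F>)"
  obtain T where T: "finite T" "\<forall>x. \<exists>t\<in>T. x - t \<notin> \<Union>\<F>"
    using finite_translates_escape_packable[OF assms] by blast
  have "negligible (\<Union>t\<in>T. (+) t ` (- \<Union>\<F>))"
    using T(1) neg by (intro negligible_Union) (auto simp: negligible_translation)
  moreover have "(\<Union>t\<in>T. (+) t ` (- \<Union>\<F>)) = UNIV"
  proof -
    have "\<exists>t\<in>T. x \<in> (+) t ` (- \<Union>\<F>)" for x
    proof -
      obtain t where "t \<in> T" "x - t \<notin> \<Union>\<F>" using T(2) by blast
      then show ?thesis by (intro bexI[of _ t] image_eqI[of _ _ "x - t"]) auto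
    qed
    then show ?thesis by blast
  qed
  ultimately show False by simp
qed

section \<open>Subgroups of the reals and their cosets in additive notation\<close>

lemma subgroup_real_iff:
  "subgroup H real_add_group \<longleftrightarrow> 0 \<in> H \<and> (\<forall>x\<in>H. \<forall>y\<in>H. x - y \<in> H)"
proof
  interpret group real_add_group by (rule group_real_add_group)
  have inv: "inv\<^bsub>real_add_group\<^esub> x = - x" for x
    by (rule inv_equality) (auto simp: real_add_group_def)
  have mult: "x \<otimes>\<^bsub>real_add_group\<^esub> y = x + y" for x y
    by (simp add: real_add_group_def)
  {
    assume "subgroup H real_add_group"
    then interpret subgroup H real_add_group .
    show "0 \<in> H \<and> (\<forall>x\<in>H. \<forall>y\<in>H. x - y \<in> H)"
      using one_closed m_closed m_inv_closed unfolding inv mult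
      by (metis diff_conv_add_uminus monoid.select_convs(2) real_add_group_def)
  next
    assume H: "0 \<in> H \<and> (\<forall>x\<in>H. \<forall>y\<in>H. x - y \<in> H)"
    then have m: "- x \<in> H" if "x \<in> H" for x
      using that by (metis diff_0)
    then have "x + y \<in> H" if "x \<in> H" "y \<in> H" for x y
      using that H by (metis diff_minus_eq_add)
    with m H show "subgroup H real_add_group"
      by (intro subgroupI) (auto simp: inv mult, auto simp: real_add_group_def)
  }
qed

lemma subgroup_real_uminus:
  "subgroup H real_add_group \<Longrightarrow> x \<in> H \<Longrightarrow> - x \<in> H"
  by (metis diff_0 subgroup_real_iff)

lemma subgroup_real_diff:
  "subgroup H real_add_group \<Longrightarrow> x \<in> H \<Longrightarrow> y \<in> H \<Longrightarrow> x - y \<in> H"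
  by (simp add: subgroup_real_iff)

lemma subgroup_real_add:
  "subgroup H real_add_group \<Longrightarrow> x \<in> H \<Longrightarrow> y \<in> H \<Longrightarrow> x + y \<in> H"
  by (metis diff_minus_eq_add subgroup_real_diff subgroup_real_uminus)

lemma subgroup_real_of_nat_mult:
  assumes "subgroup H real_add_group" "x \<in> H"
  shows "of_nat n * x \<in> H"
proof (induction n)
  case 0
  then show ?case using assms(1) by (simp add: subgroup_real_iff)
next
  case (Suc n)
  then show ?case using subgroup_real_add[OF assms Suc] by (simp add: algebra_simps)
qed

lemma mem_r_coset_real: "z \<in> H #>\<^bsub>real_add_group\<^esub> x \<longleftrightarrow> z - x \<in> H"
  unfolding r_coset_real_add_group by force

lemma r_coset_real_eq_iff:
  assumes "subgroup H real_add_group"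
  shows "H #>\<^bsub>real_add_group\<^esub> x = H #>\<^bsub>real_add_group\<^esub> y \<longleftrightarrow> x - y \<in> H"
proof
  have "0 \<in> H" using assms by (simp add: subgroup_real_iff)
  then show "x - y \<in> H" if "H #>\<^bsub>real_add_group\<^esub> x = H #>\<^bsub>real_add_group\<^esub> y"
    using that mem_r_coset_real[of x H x] mem_r_coset_real[of x H y] by simp
next
  assume xy: "x - y \<in> H"
  have "z - x \<in> H \<longleftrightarrow> z - y \<in> H" for z
    using subgroup_real_add[OF assms _ xy, of "z - x"] subgroup_real_diff[OF assms _ xy, of "z - y"]
    by auto
  then show "H #>\<^bsub>real_add_group\<^esub> x = H #>\<^bsub>real_add_group\<^esub> y"
    by (auto simp: mem_r_coset_real)
qed

lemma rcosets_real: "rcosets\<^bsub>real_add_group\<^esub> H = range (\<lambda>x. H #>\<^bsub>real_add_group\<^esub> x)"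
  by (auto simp: RCOSETS_def real_add_group_def)

section \<open>Packability of cosets and of Vitali selectors\<close>

text \<open>With \<open>N\<close> cosets, two of the multiples \<open>0, y, ..., N y\<close> share a
  coset, so some \<open>d y\<close> with 1 \<le> d \<le> N lies in \<open>H\<close>. The factorial
  of \<open>N\<close> absorbs every such \<open>d\<close>, giving one multiplier that works for all
  \<open>y\<close>.\<close>

lemma infinite_rcosets_real:
  assumes H: "subgroup H real_add_group" and "H \<noteq> UNIV"
  shows "infinite (rcosets\<^bsub>real_add_group\<^esub> H)"
proof
  let ?c = "\<lambda>x. H #>\<^bsub>real_add_group\<^esub> x"
  assume fin: "finite (rcosets\<^bsub>real_add_group\<^esub> H)"
  define N where "N = card (range ?c)"
  have fin': "finite (range ?c)" using fin by (simp add: rcosets_real)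
  have "fact N * y \<in> H" for y :: real
  proof -
    have "\<not> inj_on (\<lambda>k::nat. ?c (of_nat k * y)) {0..N}"
    proof
      assume "inj_on (\<lambda>k::nat. ?c (of_nat k * y)) {0..N}"
      then have "card {0..N} \<le> card (range ?c)"
        using fin' by (intro card_inj_on_le) auto
      then show False by (simp add: N_def)
    qed
    then obtain j k :: nat where "j \<le> N" "k \<le> N" "j \<noteq> k" "?c (of_nat j * y) = ?c (of_nat k * y)"
      by (auto simp: inj_on_def)
    then obtain j k :: nat where jk: "j < k" "k \<le> N" "?c (of_nat k * y) = ?c (of_nat j * y)"
      by (metis linorder_neqE_nat)
    then have "of_nat (k - j) * y \<in> H"
      using r_coset_real_eq_iff[OF H] by (simp add: of_nat_diff algebra_simps)
    moreover have "k - j dvd fact N" using jk by (intro dvd_fact) auto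
    then obtain m where "fact N = m * (k - j)" by (metis dvd_def mult.commute)
    then have "(fact N :: real) = of_nat m * of_nat (k - j)"
      by (metis of_nat_fact of_nat_mult)
    ultimately show ?thesis
      using subgroup_real_of_nat_mult[OF H, of "of_nat (k - j) * y" m] by (simp add: mult.assoc)
  qed
  \<comment> \<open>Divisibility enters here: every real is \<open>fact N\<close> times another
    real.\<close>
  from this[of "_ / fact N"] have "H = UNIV" by auto
  with \<open>H \<noteq> UNIV\<close> show False by simp
qed

text \<open>The shifts are representatives of the cosets of \<open>H\<close>, one for each: if two
  shifts carry points of \<open>H + y\<close> to the same point, they differ by an element of
  \<open>H\<close>.\<close>

lemma packable_r_coset:
  assumes H: "subgroup H real_add_group" and "H \<noteq> UNIV"
  shows "packable (H #>\<^bsub>real_add_group\<^esub> y)"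
proof -
  let ?c = "\<lambda>x. H #>\<^bsub>real_add_group\<^esub> x"
  obtain F where F: "inj_on ?c F" "range ?c = ?c ` F"
    using subset_image_inj[of "range ?c" ?c UNIV] by auto
  have "infinite F"
    using infinite_rcosets_real[OF assms] F by (metis finite_imageI rcosets_real)
  moreover have "f = f'" if "f \<in> F" "f' \<in> F" "x - f \<in> ?c y" "x - f' \<in> ?c y" for x f f'
  proof -
    have "f - f' \<in> H"
      using subgroup_real_diff[OF H, of "x - f' - y" "x - f - y"] that
      by (simp add: mem_r_coset_real)
    then have "?c f = ?c f'" by (simp add: r_coset_real_eq_iff[OF H])
    then show ?thesis using F(1) that by (simp add: inj_on_def)
  qed
  ultimately show ?thesis unfolding packable_def by blast
qed

lemma Vitali_selector_of_iff:
  "Vitali_selector_of Q V \<longleftrightarrow> (\<forall>y. \<exists>!x. x \<in> V \<and> x - y \<in> Q)"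
  by (simp add: Vitali_selector_of_def rcosets_real mem_r_coset_real)

text \<open>The group \<open>Q\<close> itself supplies the shifts: \<open>x - f\<close> and
  \<open>x - f'\<close> lie in the \<open>Q\<close>-coset of \<open>x\<close>, which has only one
  point in \<open>V\<close>.\<close>

lemma packable_Vitali_selector:
  assumes "V \<in> Vitali_selectors"
  shows "packable V"
proof -
  obtain Q where Q: "subgroup Q real_add_group" "closure Q = UNIV" "Vitali_selector_of Q V"
    using assms by (auto simp: Vitali_selectors_def)
  \<comment> \<open>A finite set is closed, so a finite dense \<open>Q\<close> would be the whole
    line.\<close>
  have "infinite Q"
  proof
    assume fin: "finite Q"
    then have "Q = UNIV" using Q(2) by (simp add: closure_closed finite_imp_closed)
    with fin show False using infinite_UNIV_char_0 by blast
  qed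
  moreover have "f = f'" if "f \<in> Q" "f' \<in> Q" "x - f \<in> V" "x - f' \<in> V" for x f f'
  proof -
    have "x - f - x \<in> Q" "x - f' - x \<in> Q"
      using that subgroup_real_uminus[OF Q(1)] by auto
    then have "x - f = x - f'"
      using Q(3) that unfolding Vitali_selector_of_iff by blast
    then show ?thesis by simp
  qed
  ultimately show ?thesis unfolding packable_def by blast
qed

section \<open>Existence and translation of Vitali selectors\<close>

text \<open>Needed because a semigroup of sets must be non-empty. The rationals serve as the
  countable dense subgroup.\<close>

lemma Vitali_selectors_nonempty: "Vitali_selectors \<noteq> {}"
proof -
  have Q: "subgroup \<rat> real_add_group" by (auto simp: subgroup_real_iff)
  \<comment> \<open>The choice depends on the coset as a set, so all reals in one coset receive the
    same representative.\<close>
  define r where "r C = (SOME x::real. x \<in> C)" for C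
  let ?c = "\<lambda>x. \<rat> #>\<^bsub>real_add_group\<^esub> x"
  have r: "r (?c y) - y \<in> \<rat>" for y
    using someI[of "\<lambda>x. x \<in> ?c y" y] by (simp add: r_def mem_r_coset_real)
  have "\<exists>!x. x \<in> range (\<lambda>y. r (?c y)) \<and> x - y \<in> \<rat>" for y
  proof (rule ex1I[of _ "r (?c y)"])
    show "r (?c y) \<in> range (\<lambda>y. r (?c y)) \<and> r (?c y) - y \<in> \<rat>" using r by auto
  next
    fix x assume "x \<in> range (\<lambda>y. r (?c y)) \<and> x - y \<in> \<rat>"
    then obtain z where z: "x = r (?c z)" "x - y \<in> \<rat>" by blast
    have "z - y \<in> \<rat>" using Rats_diff[OF z(2) r[of z]] z(1) by simp
    then show "x = r (?c y)" using z(1) by (simp add: r_coset_real_eq_iff[OF Q, symmetric])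
  qed
  then have "Vitali_selector_of \<rat> (range (\<lambda>y. r (?c y)))"
    by (simp add: Vitali_selector_of_iff)
  moreover have "countable (\<rat> :: real set)" by (rule countable_rat)
  moreover have "closure (\<rat> :: real set) = UNIV" by (rule Rats_closure_real)
  ultimately show ?thesis using Q unfolding Vitali_selectors_def by blast
qed

text \<open>The same \<open>Q\<close> works: \<open>x + t\<close> represents the coset of
  \<open>y\<close> exactly when \<open>x\<close> represents the coset of
  \<open>y - t\<close>.\<close>

lemma translate_Vitali_selector:
  assumes "V \<in> Vitali_selectors"
  shows "(\<lambda>x. x + t) ` V \<in> Vitali_selectors"
proof -
  have "Vitali_selector_of Q ((\<lambda>x. x + t) ` V)" if "Vitali_selector_of Q V" for Q
    unfolding Vitali_selector_of_iff
  proof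
    fix y
    have "\<exists>!x. x \<in> V \<and> x - (y - t) \<in> Q"
      using that by (simp add: Vitali_selector_of_iff)
    then obtain x where x: "x \<in> V" "x - (y - t) \<in> Q"
      "\<And>z. z \<in> V \<Longrightarrow> z - (y - t) \<in> Q \<Longrightarrow> z = x"
      by blast
    show "\<exists>!z. z \<in> (\<lambda>x. x + t) ` V \<and> z - y \<in> Q"
    proof (rule ex1I[of _ "x + t"])
      show "x + t \<in> (\<lambda>x. x + t) ` V \<and> x + t - y \<in> Q" using x(1,2) by (simp add: algebra_simps)
    next
      fix z assume "z \<in> (\<lambda>x. x + t) ` V \<and> z - y \<in> Q"
      then show "z = x + t" using x(3)[of "z - t"] by (auto simp: algebra_simps)
    qed
  qed
  then show ?thesis using assms unfolding Vitali_selectors_def by blast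
qed

lemma translate_rcosets_real:
  assumes "C \<in> rcosets\<^bsub>real_add_group\<^esub> H"
  shows "(\<lambda>x. x + t) ` C \<in> rcosets\<^bsub>real_add_group\<^esub> H"
proof -
  obtain y where "C = (\<lambda>h. h + y) ` H"
    using assms by (auto simp: rcosets_real r_coset_real_add_group)
  then have "(\<lambda>x. x + t) ` C = H #>\<^bsub>real_add_group\<^esub> (y + t)"
    by (simp add: r_coset_real_add_group image_image add.assoc)
  then show ?thesis by (auto simp: rcosets_real)
qed

section \<open>Generated semigroups and their join\<close>

text \<open>Replaces indexed unions by unions of finite non-empty subfamilies, for which joining two
  unions or taking images requires no reindexing.\<close>

lemma generated_semigroup_alt:
  "generated_semigroup \<A> = {\<Union>\<F> | \<F>. finite \<F> \<and> \<F> \<noteq> {} \<and> \<F> \<subseteq> \<A>}"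
proof (intro equalityI subsetI)
  fix S assume "S \<in> generated_semigroup \<A>"
  then obtain A and n :: nat where "S = \<Union>(A ` {1..n})" "1 \<le> n" "A ` {1..n} \<subseteq> \<A>"
    unfolding generated_semigroup_def by blast
  then show "S \<in> {\<Union>\<F> | \<F>. finite \<F> \<and> \<F> \<noteq> {} \<and> \<F> \<subseteq> \<A>}"
    by (intro CollectI exI[of _ "A ` {1..n}"]) auto
next
  fix S assume "S \<in> {\<Union>\<F> | \<F>. finite \<F> \<and> \<F> \<noteq> {} \<and> \<F> \<subseteq> \<A>}"
  then obtain \<F> where \<F>: "S = \<Union>\<F>" "finite \<F>" "\<F> \<noteq> {}" "\<F> \<subseteq> \<A>" by blast
  obtain A where A: "bij_betw A {1..card \<F>} \<F>"
    using ex_bij_betw_nat_finite_1[OF \<F>(2)] by blast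
  then have im: "A ` {1..card \<F>} = \<F>" by (simp add: bij_betw_def)
  \<comment> \<open>Non-emptiness of \<open>\<F>\<close> provides the bound \<open>1 \<le> n\<close>
    on the number of members.\<close>
  have "1 \<le> card \<F>" using \<F>(2,3) by (simp add: Suc_leI card_gt_0_iff)
  moreover have "\<forall>i\<in>{1..card \<F>}. A i \<in> \<A>" using im \<F>(4) by blast
  ultimately show "S \<in> generated_semigroup \<A>"
    unfolding generated_semigroup_def using \<F>(1) im
    by (intro CollectI exI[of _ A] exI[of _ "card \<F>"]) simp
qed

lemma generated_semigroup_Un:
  assumes "S \<in> generated_semigroup \<A>" "T \<in> generated_semigroup \<A>"
  shows "S \<union> T \<in> generated_semigroup \<A>"
proof -
  obtain \<F> \<G> where "S = \<Union>\<F>" "finite \<F>" "\<F> \<noteq> {}" "\<F> \<subseteq> \<A>"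
    "T = \<Union>\<G>" "finite \<G>" "\<G> \<subseteq> \<A>"
    using assms unfolding generated_semigroup_alt by blast
  then show ?thesis
    unfolding generated_semigroup_alt by (intro CollectI exI[of _ "\<F> \<union> \<G>"]) auto
qed

lemma generated_semigroup_nonempty:
  assumes "\<A> \<noteq> {}"
  shows "generated_semigroup \<A> \<noteq> {}"
proof -
  obtain A where "A \<in> \<A>" using assms by blast
  then have "\<Union>{A} \<in> generated_semigroup \<A>"
    unfolding generated_semigroup_alt by blast
  then show ?thesis by blast
qed

lemma generated_semigroup_image:
  assumes "\<And>A. A \<in> \<A> \<Longrightarrow> \<phi> ` A \<in> \<A>" "S \<in> generated_semigroup \<A>"
  shows "\<phi> ` S \<in> generated_semigroup \<A>"
proof -
  obtain \<F> where "S = \<Union>\<F>" "finite \<F>" "\<F> \<noteq> {}" "\<F> \<subseteq> \<A>"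
    using assms(2) unfolding generated_semigroup_alt by blast
  then show ?thesis
    using assms(1) unfolding generated_semigroup_alt
    by (intro CollectI exI[of _ "(`) \<phi> ` \<F>"]) auto
qed

lemma semigroup_of_sets_union_join:
  assumes "\<A> \<noteq> {}" "\<D> \<noteq> {}"
    and A: "\<And>S T. S \<in> \<A> \<Longrightarrow> T \<in> \<A> \<Longrightarrow> S \<union> T \<in> \<A>"
    and D: "\<And>S T. S \<in> \<D> \<Longrightarrow> T \<in> \<D> \<Longrightarrow> S \<union> T \<in> \<D>"
  shows "semigroup_of_sets (union_join \<A> \<D>)"
  unfolding semigroup_of_sets_def
proof (intro conjI allI impI)
  show "union_join \<A> \<D> \<noteq> {}" using assms(1,2) unfolding union_join_def by blast
  fix \<F> assume "finite \<F> \<and> \<F> \<noteq> {} \<and> \<F> \<subseteq> union_join \<A> \<D>"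
  then have "finite \<F>" "\<F> \<noteq> {}" "\<F> \<subseteq> union_join \<A> \<D>" by auto
  then show "\<Union>\<F> \<in> union_join \<A> \<D>"
  proof (induction \<F> rule: finite_ne_induct)
    case (singleton S)
    then show ?case by simp
  next
    case (insert S \<F>)
    then have "S \<in> union_join \<A> \<D>" "\<Union>\<F> \<in> union_join \<A> \<D>" by simp_all
    then obtain A1 D1 A2 D2 where *: "A1 \<in> \<A>" "D1 \<in> \<D>" "S = A1 \<union> D1"
      "A2 \<in> \<A>" "D2 \<in> \<D>" "\<Union>\<F> = A2 \<union> D2"
      unfolding union_join_def by blast
    \<comment> \<open>Regrouping separates the parts from \<open>\<A>\<close> and from
      \<open>\<D>\<close>, so closure of each family under binary unions suffices.\<close>
    then have "\<Union>(insert S \<F>) = (A1 \<union> A2) \<union> (D1 \<union> D2)" by auto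
    with A[OF *(1,4)] D[OF *(2,5)] show ?case unfolding union_join_def by blast
  qed
qed

section \<open>Inner regularity and Bernstein sets\<close>

text \<open>Inner regularity gives a closed \<open>T\<close> inside \<open>S\<close> that misses
  measure less than \<open>e\<close>. As \<open>T\<close> is countable, it is null, so
  \<open>S\<close> has measure at most \<open>e\<close>.\<close>

lemma negligible_if_closed_subsets_countable:
  fixes S :: "'a::euclidean_space set"
  assumes "S \<in> sets lebesgue" and countable: "\<And>T. closed T \<Longrightarrow> T \<subseteq> S \<Longrightarrow> countable T"
  shows "negligible S"
proof -
  have "emeasure lebesgue S \<le> 0 + ennreal e" if "e > 0" for e
  proof -
    obtain T where T: "closed T" "T \<subseteq> S" "S - T \<in> lmeasurable" "emeasure lebesgue (S - T) < ennreal e"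
      using sets_lebesgue_inner_closed[OF assms(1) \<open>e > 0\<close>] .
    have "T \<in> null_sets lebesgue"
      using countable[OF T(1,2)] by (intro null_sets_completionI countable_imp_null_set_lborel)
    then have "emeasure lebesgue ((S - T) \<union> T) = emeasure lebesgue (S - T)"
      using T(3) by (intro emeasure_Un_null_set) auto
    then show ?thesis using T by (simp add: Un_absorb2)
  qed
  then have "emeasure lebesgue S = 0"
    by (metis ennreal_le_epsilon le_zero_eq)
  then show ?thesis using assms(1) by (simp add: negligible_iff_null_sets null_sets_def)
qed

text \<open>Translating \<open>F\<close> by \<open>- y\<close> keeps it closed and uncountable, and
  a point of \<open>B\<close> in that translate moves back to a point of the coset in
  \<open>F\<close>.\<close>

lemma Bernstein_r_coset_meets:
  assumes "Bernstein_set B" "closed F" "uncountable F"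
  shows "(B #>\<^bsub>real_add_group\<^esub> y) \<inter> F \<noteq> {}"
proof -
  let ?F = "(\<lambda>x. - y + x) ` F"
  have "closed ?F" using assms(2) by (rule closed_translation)
  moreover have "uncountable ?F"
    using assms(3) by (subst countable_image_inj_eq) auto
  ultimately have "B \<inter> ?F \<noteq> {}"
    using assms(1) by (simp add: Bernstein_set_def)
  then show ?thesis by (auto simp: r_coset_real_add_group)
qed

theorem corollary5p2:
  fixes B :: "real set"
  assumes "Bernstein_set B"
    and "subgroup B real_add_group"
  defines "\<S> \<equiv> union_join (generated_semigroup (rcosets\<^bsub>real_add_group\<^esub> B))
                           (generated_semigroup Vitali_selectors)"
  shows "semigroup_of_sets \<S> \<and>
         (\<forall>A\<in>\<S>. A \<notin> sets lebesgue) \<and>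
         invariant_family real_translations \<S>"
proof (intro conjI ballI)
  have "rcosets\<^bsub>real_add_group\<^esub> B \<noteq> {}" by (simp add: rcosets_real)
  then show "semigroup_of_sets \<S>"
    unfolding \<S>_def
    by (intro semigroup_of_sets_union_join generated_semigroup_nonempty generated_semigroup_Un
        Vitali_selectors_nonempty)
next
  have "\<phi> ` S \<in> \<S>" if \<phi>: "\<phi> \<in> real_translations" and "S \<in> \<S>" for \<phi> S
  proof -
    obtain t where t: "\<phi> = (\<lambda>x. x + t)"
      using \<phi> by (auto simp: real_translations_def)
    obtain A D where S: "S = A \<union> D" "A \<in> generated_semigroup (rcosets\<^bsub>real_add_group\<^esub> B)"
      "D \<in> generated_semigroup Vitali_selectors"
      using \<open>S \<in> \<S>\<close> unfolding \<S>_def union_join_def by blast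
    have "\<phi> ` A \<in> generated_semigroup (rcosets\<^bsub>real_add_group\<^esub> B)"
      "\<phi> ` D \<in> generated_semigroup Vitali_selectors"
      unfolding t
      using S(2,3) by (simp_all add: generated_semigroup_image translate_rcosets_real
          translate_Vitali_selector)
    then show ?thesis unfolding S(1) image_Un \<S>_def union_join_def by blast
  qed
  then show "invariant_family real_translations \<S>"
    unfolding invariant_family_def by blast
next
  fix S assume "S \<in> \<S>"
  then obtain \<A> \<D> where S: "S = \<Union>\<A> \<union> \<Union>\<D>"
    and \<A>: "finite \<A>" "\<A> \<noteq> {}" "\<A> \<subseteq> rcosets\<^bsub>real_add_group\<^esub> B"
    and \<D>: "finite \<D>" "\<D> \<subseteq> Vitali_selectors"
    unfolding \<S>_def union_join_def generated_semigroup_alt by blast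
  \<comment> \<open>The line is itself an uncountable closed set, so the complement of
    \<open>B\<close> must meet it; hence \<open>B\<close> is proper and its cosets are
    packable.\<close>
  have "uncountable (UNIV :: real set)" by (rule uncountable_UNIV_real)
  then have "B \<noteq> UNIV"
    using assms(1) by (auto simp: Bernstein_set_def)
  then have pack: "packable T" if "T \<in> \<A> \<union> \<D>" for T
    using that \<A>(3) \<D>(2) packable_r_coset[OF assms(2)] packable_Vitali_selector
    by (auto simp: rcosets_real)
  have not_neg: "\<not> negligible (- S)"
    using packable_Union_complement_not_negligible[of "\<A> \<union> \<D>"] pack \<A>(1) \<D>(1)
    by (simp add: S)
  \<comment> \<open>Since \<open>\<A>\<close> is non-empty, \<open>S\<close> contains a coset of
    \<open>B\<close>, which leaves no room for an uncountable closed set in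
    \<open>- S\<close>.\<close>
  obtain y where "(B #>\<^bsub>real_add_group\<^esub> y) \<subseteq> S"
    using \<A>(2,3) unfolding S rcosets_real by blast
  then have "countable T" if "closed T" "T \<subseteq> - S" for T
    using that Bernstein_r_coset_meets[OF assms(1) that(1), of y] by blast
  \<comment> \<open>If \<open>S\<close> were measurable, so would be \<open>- S\<close>, which would
    then be null, contrary to \<open>not_neg\<close>.\<close>
  then show "S \<notin> sets lebesgue"
    using not_neg negligible_if_closed_subsets_countable[of "- S"]
    by (auto simp: Compl_in_sets_lebesgue)
qed

end
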